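(* Let $d$ be a positive integer. There is a bijection between the set of $d$-dimensional strongly stable partitions and the set of $d$-dimensional totally symmetric partitions which preserves the side length $n$ of the minimal $d$-dimensional box containing the partition. That is, there is a bijection $f$ from the first set to the second such that, for every $n$, $f$ restricts to a bijection $\tilde{\mathcal{B}}_d(n)\to\tilde{\mathcal{T}}_d(n)$.
   Context: Let $\mathbb{N}=\{0,1,2,\dots\}$. A $d$-dimensional partition is a finite subset $P\subset\mathbb{N}^d$ such that $(a_1,\dots,a_j,\dots,a_d)\in P$ implies $(a_1,\dots,a_j-1,\dots,a_d)\in P$ for all $1\le j\le d$ with $a_j>0$; its elements are called cells. For a cell $\alpha=(a_1,\dots,a_d)\in P$, the $j$th arm length $h_j$ is the largest integer such that $(a_1,\dots,a_j+h_j,\dots,a_d)\in P$, and $H(\alpha)=(h_1,\dots,h_d)$ is the Hook vector of $\alpha$. A partition $P$ is strongly stable if for every cell $\alpha\in P$ the Hook vector is weakly increasing: $h_1\le h_2\le\cdots\le h_d$. A partition $P$ is totally symmetric if $\alpha\in P$ implies $\pi(\alpha)\in P$ for all $\pi\in S_d$, where $S_d$ acts on $\mathbb{N}^d$ by permuting coordinates. All boxes have all $d$ sides of equal length: the box of side length $n$ is $\{0,1,\dots,n-1\}^d$. $\mathcal{P}_d(n)$ denotes the set of $d$-dimensional partitions whose largest coordinate of any cell equals $n-1$, i.e. those whose minimal containing box has side length $n$ (by convention the empty partition has minimal box of side length $0$). $\tilde{\mathcal{B}}_d(n)$ is the set of strongly stable partitions in $\mathcal{P}_d(n)$, and $\tilde{\mathcal{T}}_d(n)$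 is the set of totally symmetric partitions in $\mathcal{P}_d(n)$. *)

theory Defs
  imports "HOL-Combinatorics.Permutations"
begin

text \<open>Points of \<open>\<nat>\<^sup>d\<close> are lists of naturals of length \<open>d\<close>; coordinates are indexed from 0.\<close>

definition dpartition :: "nat \<Rightarrow> nat list set \<Rightarrow> bool" where
  "dpartition d P \<longleftrightarrow> finite P \<and> (\<forall>a\<in>P. length a = d) \<and>
     (\<forall>a\<in>P. \<forall>j<d. a ! j > 0 \<longrightarrow> a[j := a ! j - 1] \<in> P)"

text \<open>For a cell \<open>a\<close> of a partition \<open>P\<close> the set below is finite and contains 0, so ranging
  over naturals rather than integers does not affect the maximum.\<close>

definition arm_length :: "nat list set \<Rightarrow> nat list \<Rightarrow> nat \<Rightarrow> nat" where
  "arm_length P a j = Max {h. a[j := a ! j + h] \<in> P}"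

definition hook_vector :: "nat list set \<Rightarrow> nat list \<Rightarrow> nat list" where
  "hook_vector P a = map (arm_length P a) [0..<length a]"

definition strongly_stable :: "nat list set \<Rightarrow> bool" where
  "strongly_stable P \<longleftrightarrow> (\<forall>a\<in>P. sorted (hook_vector P a))"

definition totally_symmetric :: "nat \<Rightarrow> nat list set \<Rightarrow> bool" where
  "totally_symmetric d P \<longleftrightarrow> (\<forall>a\<in>P. \<forall>p. p permutes {..<d} \<longrightarrow> permute_list p a \<in> P)"

definition box :: "nat \<Rightarrow> nat \<Rightarrow> nat list set" where
  "box d n = {a. length a = d \<and> (\<forall>j<d. a ! j < n)}"

definition side_length :: "nat \<Rightarrow> nat list set \<Rightarrow> nat" where
  "side_length d P = (LEAST n. P \<subseteq> box d n)"

definition partitions_of_side :: "nat \<Rightarrow> nat \<Rightarrow> nat list set set" where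
  "partitions_of_side d n = {P. dpartition d P \<and> side_length d P = n}"

definition strongly_stable_partitions :: "nat \<Rightarrow> nat list set set" where
  "strongly_stable_partitions d = {P. dpartition d P \<and> strongly_stable P}"

definition totally_symmetric_partitions :: "nat \<Rightarrow> nat list set set" where
  "totally_symmetric_partitions d = {P. dpartition d P \<and> totally_symmetric d P}"

definition strongly_stable_of_side :: "nat \<Rightarrow> nat \<Rightarrow> nat list set set" where
  "strongly_stable_of_side d n = {P \<in> partitions_of_side d n. strongly_stable P}"

definition totally_symmetric_of_side :: "nat \<Rightarrow> nat \<Rightarrow> nat list set set" where
  "totally_symmetric_of_side d n = {P \<in> partitions_of_side d n. totally_symmetric d P}"

lemma side_length_empty: "side_length d {} = 0"
  by (simp add: side_length_def)

lemma finite_arms: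
  assumes "dpartition d P" "a \<in> P" "j < d"
  shows "finite {h. a[j := a ! j + h] \<in> P}" and "0 \<in> {h. a[j := a ! j + h] \<in> P}"
proof -
  have "finite P" using assms(1) unfolding dpartition_def by (rule conjunct1)
  have "length a = d" using assms(1,2) unfolding dpartition_def by (elim conjE) (rule bspec)
  have "inj (\<lambda>h. a[j := a ! j + h])"
  proof (rule injI)
    fix x y assume "a[j := a ! j + x] = a[j := a ! j + y]"
    then have "a[j := a ! j + x] ! j = a[j := a ! j + y] ! j" by (rule arg_cong)
    then show "x = y" using \<open>length a = d\<close> assms(3) by simp
  qed
  then show "finite {h. a[j := a ! j + h] \<in> P}"
    using finite_vimageI[OF \<open>finite P\<close>] by (simp add: vimage_def)
  show "0 \<in> {h. a[j := a ! j + h] \<in> P}" using assms by simp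
qed

text \<open>For nonempty partitions the side length is one more than the largest coordinate of any cell.\<close>

lemma side_length_nonempty:
  assumes "d > 0" "dpartition d P" "P \<noteq> {}"
  shows "side_length d P = Suc (Max (\<Union>a\<in>P. set a))"
proof -
  let ?C = "\<Union>a\<in>P. set a"
  have "finite P" and len: "\<forall>a\<in>P. length a = d"
    using assms(2) unfolding dpartition_def by blast+
  from this(1) have fin: "finite ?C" by simp
  have ne: "?C \<noteq> {}"
  proof -
    obtain a where a: "a \<in> P" using assms(3) by blast
    have "a \<noteq> []" using bspec[OF len a] assms(1) by force
    then have "hd a \<in> ?C" using a by (intro UN_I[of a]) simp_all
    then show ?thesis by blast
  qed
  have *: "P \<subseteq> box d n \<longleftrightarrow> Suc (Max ?C) \<le> n" for n
  proof -
    have "P \<subseteq> box d n \<longleftrightarrow> (\<forall>a\<in>P. \<forall>c\<in>set a. c < n)"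
    proof -
      have "a \<in> box d n \<longleftrightarrow> (\<forall>c\<in>set a. c < n)" if "a \<in> P" for a
        using bspec[OF len that] by (simp add: box_def all_set_conv_all_nth)
      then show ?thesis by (simp only: subset_eq cong: ball_cong)
    qed
    also have "\<dots> \<longleftrightarrow> (\<forall>c\<in>?C. c < n)" by blast
    also have "\<dots> \<longleftrightarrow> Suc (Max ?C) \<le> n"
      using Max_less_iff[OF fin ne] by (simp only: Suc_le_eq)
    finally show ?thesis .
  qed
  show ?thesis unfolding side_length_def * by (rule Least_equality) auto
qed

end

theory Submission
  imports Defs
begin

text \<open>
  A partition is strongly stable iff it is closed under moving a unit from a coordinate to the next
  one.  In terms of the partial sums \<open>s\<^sub>i = a\<^sub>1 + \<dots> + a\<^sub>i\<close> such a move decreases a single \<open>s\<^sub>i\<close> by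
  one, and removing a unit from the last coordinate decreases \<open>s\<^sub>d\<close>.  Hence strongly stable
  partitions are the finite order ideals in the poset of weakly increasing sequences
  \<open>s\<^sub>1 \<le> \<dots> \<le> s\<^sub>d\<close> ordered componentwise.  The same ideals describe totally symmetric partitions,
  which are determined by their weakly increasing cells.  Moving all units of a cell to the last
  coordinate shows that the largest coordinate in a strongly stable partition is the largest
  value of \<open>s\<^sub>d\<close>, so the side length is preserved.
\<close>

section \<open>Partial sums and successive differences\<close>

fun psums :: "nat \<Rightarrow> nat list \<Rightarrow> nat list" where
  "psums s [] = []"
| "psums s (x # xs) = (s + x) # psums (s + x) xs"

text \<open>Subtraction is truncated, so \<open>psums s\<close> undoes \<open>diffs s\<close> only
  on sorted lists with all entries at least \<open>s\<close>.\<close>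

fun diffs :: "nat \<Rightarrow> nat list \<Rightarrow> nat list" where
  "diffs s [] = []"
| "diffs s (x # xs) = (x - s) # diffs x xs"

lemma length_psums [simp]: "length (psums s xs) = length xs"
  by (induction xs arbitrary: s) auto

lemma length_diffs [simp]: "length (diffs s xs) = length xs"
  by (induction xs arbitrary: s) auto

lemma diffs_psums [simp]: "diffs s (psums s xs) = xs"
  by (induction xs arbitrary: s) auto

lemma psums_diffs: "sorted (s # xs) \<Longrightarrow> psums s (diffs s xs) = xs"
  by (induction xs arbitrary: s) auto

lemma psums_diffs_sort [simp]: "psums 0 (diffs 0 (sort xs)) = sort xs"
  by (rule psums_diffs) simp

lemma psums_append: "psums s (xs @ ys) = psums s xs @ psums (s + sum_list xs) ys"
  by (induction xs arbitrary: s) (auto simp: add.assoc)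

lemma psums_ge: "x \<in> set (psums s xs) \<Longrightarrow> s \<le> x"
  by (induction xs arbitrary: s) fastforce+

lemma psums_le: "x \<in> set (psums s xs) \<Longrightarrow> x \<le> s + sum_list xs"
  by (induction xs arbitrary: s) fastforce+

lemma sorted_psums: "sorted (psums s xs)"
  by (induction xs arbitrary: s) (auto dest: psums_ge)

lemma psums_mono:
  "s \<le> t \<Longrightarrow> list_all2 (\<le>) xs ys \<Longrightarrow> list_all2 (\<le>) (psums s xs) (psums t ys)"
  by (rotate_tac, induction xs ys arbitrary: s t rule: list_all2_induct) auto

lemma nth_le_psums: "list_all2 (\<le>) xs (psums s xs)"
  by (induction xs arbitrary: s) auto

section \<open>Componentwise order and sorting\<close>

lemma list_all2_le_refl [simp]: "list_all2 (\<le>) xs (xs :: 'a :: preorder list)"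
  by (simp add: list_all2_refl)

text \<open>If the two insertions stop at different depths, the tail where one has stopped is read
  as an insertion of its own head (\<open>x1 # xs\<close> as \<open>insort x1 xs\<close>), so the
  induction hypothesis still applies.\<close>

lemma list_all2_insort:
  fixes x y :: "'a :: linorder"
  assumes "list_all2 (\<le>) xs ys" "sorted xs" "sorted ys" "x \<le> y"
  shows "list_all2 (\<le>) (insort x xs) (insort y ys)"
  using assms
proof (induction xs ys arbitrary: x y rule: list_all2_induct)
  case Nil
  then show ?case by simp
next
  case (Cons x1 xs y1 ys)
  note IH = Cons.IH
  have s: "sorted xs" "sorted ys" "insort x1 xs = x1 # xs" "insort y1 ys = y1 # ys"
    using Cons.prems by (auto intro: insort_is_Cons)
  show ?case
  proof (cases "x \<le> x1"; cases "y \<le> y1")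
    assume "x \<le> x1" "\<not> y \<le> y1"
    then show ?thesis using IH[of x1 y] s Cons.hyps by auto
  next
    assume "\<not> x \<le> x1" "y \<le> y1"
    then show ?thesis using IH[of x y1] s Cons.prems by auto
  qed (use Cons s in auto)
qed

lemma list_all2_sort:
  fixes xs ys :: "'a :: linorder list"
  assumes "list_all2 (\<le>) xs ys"
  shows "list_all2 (\<le>) (sort xs) (sort ys)"
  using assms by (induction rule: list_all2_induct) (auto intro: list_all2_insort)

section \<open>Closure under removing and shifting units\<close>

definition removal_closed :: "nat list set \<Rightarrow> bool" where
  "removal_closed P \<longleftrightarrow> (\<forall>u x v. u @ Suc x # v \<in> P \<longrightarrow> u @ x # v \<in> P)"

definition shift_closed :: "nat list set \<Rightarrow> bool" where
  "shift_closed P \<longleftrightarrow> (\<forall>u x y v. u @ Suc x # y # v \<in> P \<longrightarrow> u @ x # Suc y # v \<in> P)"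

text \<open>Slices with a fixed first coordinate are the sets that the inductions along a cell
  descend into.\<close>

lemma removal_closed_tails: "removal_closed P \<Longrightarrow> removal_closed {v. x # v \<in> P}"
  unfolding removal_closed_def by (metis append_Cons mem_Collect_eq)

lemma shift_closed_tails: "shift_closed P \<Longrightarrow> shift_closed {v. x # v \<in> P}"
  unfolding shift_closed_def by (metis append_Cons mem_Collect_eq)

lemma removal_closed_hd:
  assumes "removal_closed P" "(n + x) # v \<in> P"
  shows "x # v \<in> P"
  using assms(2)
proof (induction n)
  case (Suc n)
  then show ?case using assms(1) unfolding removal_closed_def by (metis add_Suc append_Nil)
qed simp

lemma shift_closed_hd:
  assumes "shift_closed P" "(n + x) # y # v \<in> P"
  shows "x # (n + y) # v \<in> P"
  using assms(2)
proof (induction n arbitrary: y)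
  case (Suc n)
  then have "(n + x) # Suc y # v \<in> P"
    using assms(1) unfolding shift_closed_def by (metis add_Suc append_Nil)
  then show ?case using Suc.IH[of "Suc y"] by simp
qed simp

lemma removal_closed_le:
  assumes "list_all2 (\<le>) b a" "removal_closed P" "a \<in> P"
  shows "b \<in> P"
  using assms
proof (induction b a arbitrary: P rule: list_all2_induct)
  case (Cons y ys x xs)
  then have "y # xs \<in> P" using removal_closed_hd[of P "x - y" y xs] by simp
  then show ?case using Cons.IH[OF removal_closed_tails[OF Cons.prems(1)], of y] by simp
qed simp

text \<open>Elementary moves reach every cell below \<open>a\<close> in the partial sum order. They
  correct the first coordinate, then continue in its slice; the offset \<open>s\<close> records the
  sum of the coordinates already fixed. In the last coordinate the surplus is removed.\<close>

lemma shift_closed_psums_le: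
  assumes "removal_closed P" "shift_closed P" "a \<in> P"
    and "list_all2 (\<le>) (psums s b) (psums s a)"
  shows "b \<in> P"
  using assms
proof (induction "length a" arbitrary: P a b s)
  case 0
  then show ?case by (cases b) auto
next
  case (Suc n)
  obtain x xs where a: "a = x # xs" using Suc.hyps(2) by (cases a) auto
  obtain y ys where b: "b = y # ys" using Suc.prems(4) a by (cases b) auto
  have "y \<le> x" using Suc.prems(4) a b by simp
  show ?case
  proof (cases xs)
    case Nil
    then have "ys = []" using Suc.prems(4) a b by (cases ys) auto
    then show ?thesis
      using removal_closed_hd[of P "x - y" y "[]"] Suc.prems a b Nil \<open>y \<le> x\<close> by simp
  next
    case (Cons z zs)
    \<comment> \<open>The surplus \<open>x - y\<close> goes into the second coordinate, so all later
      partial sums are unchanged.\<close>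
    let ?c = "((x - y) + z) # zs"
    have "?c \<in> {v. y # v \<in> P}"
      using shift_closed_hd[of P "x - y" y z zs] Suc.prems a Cons \<open>y \<le> x\<close> by simp
    moreover have "psums (s + y) ?c = psums (s + x) xs"
      using \<open>y \<le> x\<close> Cons by (simp add: add.assoc)
    then have "list_all2 (\<le>) (psums (s + y) ys) (psums (s + y) ?c)"
      using Suc.prems(4) a b by simp
    moreover have "n = length ?c" using Suc.hyps(2) a Cons by simp
    ultimately have "ys \<in> {v. y # v \<in> P}"
      using Suc.hyps(1) removal_closed_tails[OF Suc.prems(1)] shift_closed_tails[OF Suc.prems(2)]
      by blast
    then show ?thesis using b by simp
  qed
qed

section \<open>Strongly stable partitions as order ideals\<close>

lemma dpartition_iff:
  "dpartition d P \<longleftrightarrow> finite P \<and> (\<forall>a\<in>P. length a = d) \<and> removal_closed P"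
proof -
  have "(\<forall>a\<in>P. \<forall>j<d. a ! j > 0 \<longrightarrow> a[j := a ! j - 1] \<in> P) \<longleftrightarrow> removal_closed P"
    if len: "\<forall>a\<in>P. length a = d"
  proof
    assume *: "\<forall>a\<in>P. \<forall>j<d. a ! j > 0 \<longrightarrow> a[j := a ! j - 1] \<in> P"
    show "removal_closed P"
      unfolding removal_closed_def
    proof (intro allI impI)
      fix u x v assume "u @ Suc x # v \<in> P"
      then show "u @ x # v \<in> P"
        using *[rule_format, of "u @ Suc x # v" "length u"] len by (force simp: nth_append)
    qed
  next
    assume *: "removal_closed P"
    show "\<forall>a\<in>P. \<forall>j<d. a ! j > 0 \<longrightarrow> a[j := a ! j - 1] \<in> P"
    proof (intro ballI allI impI)
      fix a j assume "a \<in> P" "j < d" "a ! j > 0"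
      then show "a[j := a ! j - 1] \<in> P"
        using * len id_take_nth_drop[of j a] unfolding removal_closed_def
        by (metis One_nat_def Suc_pred upd_conv_take_nth_drop)
    qed
  qed
  then show ?thesis unfolding dpartition_def by blast
qed

lemma arm_length_ge:
  assumes "dpartition d P" "a \<in> P" "j < d" "a[j := a ! j + h] \<in> P"
  shows "h \<le> arm_length P a j"
  unfolding arm_length_def using finite_arms(1)[OF assms(1-3)] assms(4) by (intro Max_ge) auto

lemma arm_length_mem:
  assumes "dpartition d P" "a \<in> P" "j < d"
  shows "a[j := a ! j + arm_length P a j] \<in> P"
  using Max_in[OF finite_arms(1)[OF assms]] finite_arms(2)[OF assms]
  unfolding arm_length_def by blast

lemma sorted_hook_vector_iff:
  "sorted (hook_vector P a) \<longleftrightarrow>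
    (\<forall>j. Suc j < length a \<longrightarrow> arm_length P a j \<le> arm_length P a (Suc j))"
  unfolding hook_vector_def sorted_iff_nth_Suc by auto

text \<open>Stability is applied at \<open>?c\<close>, the cell with the unit removed: the original
  cell shows that its arm in direction \<open>?j\<close> is at least 1, hence so is the next
  arm.\<close>

lemma strongly_stable_imp_shift_closed:
  assumes P: "dpartition d P" and "strongly_stable P"
  shows "shift_closed P"
  unfolding shift_closed_def
proof (intro allI impI)
  fix u x y v assume *: "u @ Suc x # y # v \<in> P"
  let ?c = "u @ x # y # v" and ?j = "length u"
  have rc: "removal_closed P" using P unfolding dpartition_iff by simp
  then have c: "?c \<in> P" using * unfolding removal_closed_def by blast
  then have len: "length ?c = d" using P unfolding dpartition_def by blast
  let ?h = "arm_length P ?c (Suc ?j)"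
  have "1 \<le> arm_length P ?c ?j"
    using arm_length_ge[OF P c, of ?j 1] * len by (simp add: nth_append)
  also have "\<dots> \<le> ?h"
    using assms(2) c len unfolding strongly_stable_def sorted_hook_vector_iff by auto
  finally have h: "1 \<le> ?h" .
  have "u @ x # (y + ?h) # v \<in> P"
    using arm_length_mem[OF P c, of "Suc ?j"] len by (simp add: nth_append list_update_append)
  moreover have "list_all2 (\<le>) (u @ x # Suc y # v) (u @ x # (y + ?h) # v)"
    using h by (auto intro!: list_all2_appendI)
  ultimately show "u @ x # Suc y # v \<in> P" using removal_closed_le rc by blast
qed

lemma strongly_stable_partitions_iff:
  "P \<in> strongly_stable_partitions d \<longleftrightarrow> finite P \<and> (\<forall>a\<in>P. length a = d) \<and>
    (\<forall>a\<in>P. \<forall>b. list_all2 (\<le>) (psums 0 b) (psums 0 a) \<longrightarrow> b \<in> P)"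
  (is "_ \<longleftrightarrow> ?R")
proof
  assume "P \<in> strongly_stable_partitions d"
  then have P: "dpartition d P" "strongly_stable P" unfolding strongly_stable_partitions_def by auto
  then show ?R
    using strongly_stable_imp_shift_closed[OF P] shift_closed_psums_le
    unfolding dpartition_iff by blast
next
  assume R: ?R
  then have *: "b \<in> P" if "a \<in> P" "list_all2 (\<le>) (psums 0 b) (psums 0 a)" for a b
    using that by blast
  have "removal_closed P"
    unfolding removal_closed_def
    by (auto intro!: list_all2_appendI psums_mono elim!: *)
  with R have P: "dpartition d P" unfolding dpartition_iff by blast
  have "arm_length P a j \<le> arm_length P a (Suc j)" if a: "a \<in> P" and j: "Suc j < length a" for a j
  proof (rule arm_length_ge[OF P a])
    let ?h = "arm_length P a j"
    obtain u x y v where uv: "a = u @ x # y # v" "length u = j"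
      using j id_take_nth_drop[of j a] Cons_nth_drop_Suc[of "Suc j" a]
      by (metis Suc_lessD length_take min.absorb4)
    have len: "length a = d" using R a by blast
    have "a[j := a ! j + ?h] \<in> P" using arm_length_mem[OF P a] j len by simp
    \<comment> \<open>Moving the whole arm from \<open>j\<close> to \<open>Suc j\<close> lowers only
      the partial sum at index \<open>j\<close>, so the ideal contains the new cell.\<close>
    then show "a[Suc j := a ! Suc j + ?h] \<in> P"
      using uv
      by (elim *) (auto simp: nth_append list_update_append psums_append add_ac intro!: list_all2_appendI)
    show "Suc j < d" using j len by simp
  qed
  then show "P \<in> strongly_stable_partitions d"
    using P unfolding strongly_stable_partitions_def strongly_stable_def sorted_hook_vector_iff
    by blast
qed

section \<open>Totally symmetric partitions as order ideals\<close>

lemma totally_symmetric_iff_mset: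
  assumes "\<forall>a\<in>P. length a = d"
  shows "totally_symmetric d P \<longleftrightarrow> (\<forall>a\<in>P. \<forall>b. mset b = mset a \<longrightarrow> b \<in> P)"
proof
  assume *: "totally_symmetric d P"
  show "\<forall>a\<in>P. \<forall>b. mset b = mset a \<longrightarrow> b \<in> P"
  proof (intro ballI allI impI)
    fix a b assume "a \<in> P" "mset b = mset a"
    then show "b \<in> P"
      using * assms mset_eq_permutation[of b a] unfolding totally_symmetric_def by metis
  qed
next
  assume "\<forall>a\<in>P. \<forall>b. mset b = mset a \<longrightarrow> b \<in> P"
  then show "totally_symmetric d P"
    using assms unfolding totally_symmetric_def by (auto simp: mset_permute_list)
qed

text \<open>Symmetry leads from \<open>a\<close> to \<open>sort a\<close>, removals lead down to
  \<open>sort b\<close>, and symmetry leads on to \<open>b\<close>. Conversely, sorting is monotone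
  and identifies rearrangements.\<close>

lemma totally_symmetric_partitions_iff:
  "T \<in> totally_symmetric_partitions d \<longleftrightarrow> finite T \<and> (\<forall>a\<in>T. length a = d) \<and>
    (\<forall>a\<in>T. \<forall>b. list_all2 (\<le>) (sort b) (sort a) \<longrightarrow> b \<in> T)"
  (is "_ \<longleftrightarrow> ?R")
proof
  assume "T \<in> totally_symmetric_partitions d"
  then have T: "finite T" "\<forall>a\<in>T. length a = d" "removal_closed T" "totally_symmetric d T"
    unfolding totally_symmetric_partitions_def dpartition_iff by auto
  have perm: "b \<in> T" if "a \<in> T" "mset b = mset a" for a b
    using T(4) that unfolding totally_symmetric_iff_mset[OF T(2)] by blast
  have "b \<in> T" if "a \<in> T" "list_all2 (\<le>) (sort b) (sort a)" for a b
  proof -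
    have "sort a \<in> T" using perm[OF that(1)] by simp
    then have "sort b \<in> T" using removal_closed_le that(2) T(3) by blast
    then show ?thesis using perm by simp
  qed
  then show ?R using T by blast
next
  assume R: ?R
  then have *: "b \<in> T" if "a \<in> T" "list_all2 (\<le>) (sort b) (sort a)" for a b
    using that by blast
  have "removal_closed T"
    unfolding removal_closed_def
    by (auto intro!: list_all2_appendI list_all2_sort elim!: *)
  moreover have "totally_symmetric d T"
    using R totally_symmetric_iff_mset[of T d] *
    by (metis list_all2_le_refl properties_for_sort mset_sort sorted_sort)
  ultimately show "T \<in> totally_symmetric_partitions d"
    using R unfolding totally_symmetric_partitions_def dpartition_iff by blast
qed

section \<open>The bijection and its inverse\<close>

text \<open>These are all rearrangements of the partial sum sequences of cells of
  \<open>P\<close>.\<close>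

definition symmetrize :: "nat list set \<Rightarrow> nat list set" where
  "symmetrize P = {b. diffs 0 (sort b) \<in> P}"

definition unsymmetrize :: "nat list set \<Rightarrow> nat list set" where
  "unsymmetrize T = {a. psums 0 a \<in> T}"

lemma sort_psums [simp]: "sort (psums s xs) = psums s xs"
  by (simp add: sorted_psums sorted_sort_id)

lemma symmetrize_mem:
  assumes P: "P \<in> strongly_stable_partitions d"
  shows "symmetrize P \<in> totally_symmetric_partitions d"
  unfolding totally_symmetric_partitions_iff
proof (intro conjI ballI allI impI)
  have len: "length b = d" if "b \<in> symmetrize P" for b
    using P that unfolding strongly_stable_partitions_iff symmetrize_def by fastforce
  then show "length b = d" if "b \<in> symmetrize P" for b using that .
  \<comment> \<open>Finiteness: each member is a list of length \<open>d\<close> over the entries of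
    a single \<open>psums 0 a\<close>.\<close>
  have "symmetrize P \<subseteq> (\<Union>a\<in>P. {b. set b \<subseteq> set (psums 0 a) \<and> length b = d})"
  proof
    fix b assume b: "b \<in> symmetrize P"
    have "set b \<subseteq> set (psums 0 (diffs 0 (sort b)))" by simp
    then show "b \<in> (\<Union>a\<in>P. {b. set b \<subseteq> set (psums 0 a) \<and> length b = d})"
      using b len unfolding symmetrize_def by blast
  qed
  moreover have "finite \<dots>"
    using P unfolding strongly_stable_partitions_iff
    by (intro finite_UN_I finite_lists_length_eq) auto
  ultimately show "finite (symmetrize P)" by (rule finite_subset)
  fix a b assume "a \<in> symmetrize P" "list_all2 (\<le>) (sort b) (sort a)"
  then show "b \<in> symmetrize P"
    using P unfolding strongly_stable_partitions_iff symmetrize_def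
    by (metis mem_Collect_eq psums_diffs_sort)
qed

lemma unsymmetrize_mem:
  assumes T: "T \<in> totally_symmetric_partitions d"
  shows "unsymmetrize T \<in> strongly_stable_partitions d"
  unfolding strongly_stable_partitions_iff
proof (intro conjI ballI allI impI)
  have "inj (psums 0)" by (metis diffs_psums injI)
  then show "finite (unsymmetrize T)"
    using T finite_vimageI[of T "psums 0"]
    unfolding totally_symmetric_partitions_iff unsymmetrize_def vimage_def by blast
  show "length a = d" if "a \<in> unsymmetrize T" for a
    using T that unfolding totally_symmetric_partitions_iff unsymmetrize_def by fastforce
  fix a b assume "a \<in> unsymmetrize T" "list_all2 (\<le>) (psums 0 b) (psums 0 a)"
  then show "b \<in> unsymmetrize T"
    using T unfolding totally_symmetric_partitions_iff unsymmetrize_def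
    by (metis mem_Collect_eq sort_psums)
qed

lemma unsymmetrize_symmetrize: "unsymmetrize (symmetrize P) = P"
  unfolding unsymmetrize_def symmetrize_def by simp

text \<open>The composite consists of all \<open>b\<close> with \<open>sort b\<close> in
  \<open>T\<close>; this is \<open>T\<close>, since \<open>b\<close> and \<open>sort b\<close> lie
  below each other in the sorted order.\<close>

lemma symmetrize_unsymmetrize:
  assumes "T \<in> totally_symmetric_partitions d"
  shows "symmetrize (unsymmetrize T) = T"
proof -
  have "sort b \<in> T \<longleftrightarrow> b \<in> T" for b
    using assms unfolding totally_symmetric_partitions_iff
    by (metis list_all2_le_refl sorted_sort sorted_sort_id)
  then show ?thesis unfolding unsymmetrize_def symmetrize_def by simp
qed

lemma bij_betw_symmetrize:
  "bij_betw symmetrize (strongly_stable_partitions d) (totally_symmetric_partitions d)"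
  by (rule bij_betw_byWitness[where f' = unsymmetrize])
    (auto simp: symmetrize_mem unsymmetrize_mem unsymmetrize_symmetrize symmetrize_unsymmetrize)

section \<open>Preservation of the side length\<close>

lemma box_iff: "a \<in> box d n \<longleftrightarrow> length a = d \<and> (\<forall>x\<in>set a. x < n)"
  unfolding box_def by (auto simp: all_set_conv_all_nth)

text \<open>Each coordinate is at most its partial sum, and the largest partial sum is itself a
  coordinate of some cell of \<open>P\<close>.\<close>

lemma symmetrize_subset_box_iff:
  assumes "d > 0" and P: "P \<in> strongly_stable_partitions d"
  shows "symmetrize P \<subseteq> box d n \<longleftrightarrow> P \<subseteq> box d n"
proof
  assume *: "symmetrize P \<subseteq> box d n"
  show "P \<subseteq> box d n"
  proof
    fix a assume "a \<in> P"
    then have "psums 0 a \<in> box d n" using * unfolding symmetrize_def by auto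
    then show "a \<in> box d n"
      using nth_le_psums[of a 0] unfolding box_def
      by (auto simp: list_all2_conv_all_nth intro: le_less_trans)
  qed
next
  assume *: "P \<subseteq> box d n"
  show "symmetrize P \<subseteq> box d n"
  proof
    fix b assume "b \<in> symmetrize P"
    define a where "a = diffs 0 (sort b)"
    have a: "a \<in> P" "length a = d"
      using \<open>b \<in> symmetrize P\<close> P
      unfolding symmetrize_def a_def strongly_stable_partitions_iff by auto
    then obtain u y where u: "a = u @ [y]" using assms(1) by (cases a rule: rev_cases) auto
    \<comment> \<open>All units of \<open>a\<close> are moved to the last coordinate, which exists
      as \<open>d > 0\<close>; the partial sums become zeros followed by the total, so
      \<open>?e\<close> lies below \<open>a\<close>.\<close>
    let ?e = "replicate (length u) 0 @ [sum_list a]"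
    have "list_all2 (\<le>) (replicate (length u) 0) u"
      by (simp add: list_all2_conv_all_nth)
    then have "list_all2 (\<le>) (psums 0 ?e) (psums 0 a)"
      unfolding u psums_append
      by (intro list_all2_appendI psums_mono[OF order_refl]) (simp_all add: sum_list_replicate)
    then have "?e \<in> P" using a P unfolding strongly_stable_partitions_iff by blast
    then have "sum_list a < n" using * by (auto simp: box_iff)
    moreover have "set b = set (psums 0 a)" "length b = d"
      using a unfolding a_def by simp_all
    ultimately show "b \<in> box d n"
      unfolding box_iff using psums_le[of _ 0 a] by fastforce
  qed
qed

lemma bij_betw_Collect_preserving:
  assumes "bij_betw f A B" "\<And>x. x \<in> A \<Longrightarrow> s (f x) = s x"
  shows "bij_betw f {x \<in> A. s x = n} {y \<in> B. s y = n}"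
  using assms unfolding bij_betw_def inj_on_def by force

theorem theorem1:
  fixes d :: nat
  assumes "d > 0"
  shows "\<exists>f. bij_betw f (strongly_stable_partitions d) (totally_symmetric_partitions d) \<and>
             (\<forall>n. bij_betw f (strongly_stable_of_side d n) (totally_symmetric_of_side d n))"
proof (intro exI[of _ symmetrize] conjI allI bij_betw_symmetrize)
  fix n
  have "strongly_stable_of_side d n = {P \<in> strongly_stable_partitions d. side_length d P = n}"
    "totally_symmetric_of_side d n = {P \<in> totally_symmetric_partitions d. side_length d P = n}"
    unfolding strongly_stable_of_side_def totally_symmetric_of_side_def partitions_of_side_def
      strongly_stable_partitions_def totally_symmetric_partitions_def by auto
  \<comment> \<open>Both side lengths are least elements of the same set of box sizes, which also
    covers the empty partition.\<close>
  moreover have "side_length d (symmetrize P) = side_length d P"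
    if "P \<in> strongly_stable_partitions d" for P
    unfolding side_length_def symmetrize_subset_box_iff[OF assms that] ..
  ultimately show "bij_betw symmetrize (strongly_stable_of_side d n) (totally_symmetric_of_side d n)"
    using bij_betw_Collect_preserving[OF bij_betw_symmetrize, of d "side_length d"] by simp
qed

end
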